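(* For all integers $n\geq 1$, $$\mathrm{Disc}(p_n) = (-1)^n\, 2^{4n^2+2}\,(n+1)^{2n-3}\,(n+2)^{2n-2}.$$
   Context: The polynomials $p_n(z)\in\mathbb{Z}[z]$ ($n\ge 0$) are defined by the generating function (formal power series in $t$) $$\frac{1}{\left(1-(z+1)^2t\right)^2\left(1-(z-1)^2t\right)}=\sum_{n=0}^\infty p_n(z)t^n .$$ The polynomial $p_n$ has degree $2n$. For a polynomial $f$ of degree $\mu$ with leading coefficient $a_\mu$ and complex zeros $\alpha_1,\dots,\alpha_\mu$ (with multiplicity), the discriminant is $$\mathrm{Disc}(f)=(-1)^{\frac{\mu(\mu-1)}{2}}a_{\mu}^{-1}\mathrm{Res}(f,f')=(-1)^{\frac{\mu(\mu-1)}{2}}a_{\mu}^{\mu-2}\prod_{j=1}^{\mu}f'(\alpha_j),$$ where $\mathrm{Res}$ denotes the resultant (Sylvester determinant). *)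

theory Defs
  imports
    Complex_Main
    "HOL-Computational_Algebra.Formal_Power_Series"
    "Subresultants.Resultant_Prelim"
begin

text \<open>Power series in \<open>t\<close> (\<^const>\<open>fps_X\<close>) with coefficients in \<open>\<int>[z]\<close>, where \<open>z\<close> is \<open>[:0, 1:]\<close>.\<close>

definition gf_denominator :: "int poly fps" where
  "gf_denominator =
     (1 - fps_const (([:0, 1:] + 1)\<^sup>2) * fps_X)\<^sup>2 * (1 - fps_const (([:0, 1:] - 1)\<^sup>2) * fps_X)"

text \<open>
  There is no \<^const>\<open>inverse\<close> on \<^typ>\<open>int poly\<close>, hence none on the power series over it, so the
  reciprocal is the library's \<^const>\<open>fps_right_inverse_constructor\<close>. It is a true inverse because
  the constant term of the denominator is 1; the lemmas below state this and its uniqueness.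
\<close>

definition p_poly :: "nat \<Rightarrow> int poly" where
  "p_poly n = fps_nth (fps_right_inverse gf_denominator 1) n"

lemma gf_p_poly: "gf_denominator * Abs_fps p_poly = 1"
proof -
  have "Abs_fps p_poly = fps_right_inverse gf_denominator 1"
    by (rule fps_ext) (simp add: p_poly_def)
  moreover have "fps_nth gf_denominator 0 * 1 = 1"
    by (simp add: gf_denominator_def fps_power_zeroth_eq_one)
  ultimately show ?thesis
    using fps_right_inverse[of gf_denominator 1] by simp
qed

lemma gf_p_poly_unique:
  assumes "gf_denominator * Abs_fps q = 1"
  shows "q = p_poly"
proof -
  have "Abs_fps q = (gf_denominator * Abs_fps p_poly) * Abs_fps q"
    by (simp add: gf_p_poly)
  also have "\<dots> = Abs_fps p_poly * (gf_denominator * Abs_fps q)"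
    by (simp only: mult_ac)
  also have "\<dots> = Abs_fps p_poly"
    by (simp add: assms)
  finally show ?thesis
    by (simp add: fps_eq_iff fun_eq_iff)
qed

definition Disc :: "'a :: field poly \<Rightarrow> 'a" where
  "Disc f = (-1) ^ (degree f * (degree f - 1) div 2)
              * inverse (lead_coeff f) * resultant f (pderiv f)"

end

theory Submission
  imports
    Defs
    "Subresultants.Subresultant"
    "HOL-Computational_Algebra.Fundamental_Theorem_Algebra"
begin

text \<open>
  The recurrence \<open>p\<^sub>n\<^sub>+\<^sub>1 = (z - 1)\<^sup>2 p\<^sub>n + (n + 2) (z + 1)\<^bsup>2n+2\<^esup>\<close> yields by induction
  \<open>z (z - 1) p\<^sub>n' = (2 (n + 1) z + 2) p\<^sub>n - (n + 1) (n + 2) (z + 1)\<^bsup>2n+1\<^esup>\<close>. At a root of \<open>p\<^sub>n\<close> the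
  first term on the right vanishes, so the product of \<open>p\<^sub>n'\<close> over the roots is determined by the values
  of \<open>p\<^sub>n\<close> at 0, 1 and -1. This product is turned into the Sylvester determinant by Poisson's
  formula.
\<close>

section \<open>Poisson's product formula for the Sylvester determinant\<close>

text \<open>Reading each Sylvester row as a polynomial, highest coefficient first, turns row
  operations into polynomial arithmetic. The formal degrees \<open>m\<close> and \<open>n\<close>
  only bound the true ones.\<close>

lemma resultant_sub_as_rows:
  assumes "degree f \<le> m" and "degree g \<le> n"
  shows "resultant_sub m n f g = det (mat (m + n) (m + n) (\<lambda>(i, j).
    coeff (if i < n then monom 1 (n - 1 - i) * f else monom 1 (m + n - 1 - i) * g) (m + n - 1 - j)))"
proof -
  have "sylvester_mat_sub m n f g = mat (m + n) (m + n) (\<lambda>(i, j).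
    coeff (if i < n then monom 1 (n - 1 - i) * f else monom 1 (m + n - 1 - i) * g) (m + n - 1 - j))"
    (is "_ = ?R")
  proof (rule eq_matI)
    fix i j assume "i < dim_row ?R" "j < dim_col ?R"
    then show "sylvester_mat_sub m n f g $$ (i, j) = ?R $$ (i, j)"
      using assms
      by (auto simp: sylvester_mat_sub_index coeff_monom_mult coeff_eq_0
          intro!: arg_cong[where f = "coeff f"] arg_cong[where f = "coeff g"] coeff_eq_0)
  qed simp_all
  then show ?thesis by (simp add: resultant_sub_def)
qed

text \<open>
  The matrix of the \<open>r i\<close> factors as \<open>B V\<close>: row \<open>i\<close> of \<open>B\<close> lists quotient and remainder of \<open>r i\<close> modulo
  \<open>x - a\<close>, and the unipotent bidiagonal \<open>V\<close> multiplies the quotient by \<open>x - a\<close> and adds the remainder.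
\<close>

lemma det_coeff_rows_linear_factor:
  fixes r s :: "nat \<Rightarrow> 'a :: idom poly"
  assumes r: "\<And>i. i < N \<Longrightarrow> r i = [:- a, 1:] * s i"
    and r': "r N = [:- a, 1:] * s N + [:v:]"
    and deg: "\<And>i. i \<le> N \<Longrightarrow> coeff (s i) N = 0"
  shows "det (mat (Suc N) (Suc N) (\<lambda>(i, j). coeff (r i) (N - j))) =
    v * det (mat N N (\<lambda>(i, j). coeff (s i) (N - 1 - j)))"
proof -
  define B where "B = mat (Suc N) (Suc N)
    (\<lambda>(i, j). if j < N then coeff (s i) (N - 1 - j) else if i = N then v else 0)"
  define V :: "'a mat" where "V = mat (Suc N) (Suc N)
    (\<lambda>(k, j). if k = j then 1 else if Suc k = j then - a else 0)"
  have "mat (Suc N) (Suc N) (\<lambda>(i, j). coeff (r i) (N - j)) = B * V"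
  proof (rule eq_matI)
    fix i j assume "i < dim_row (B * V)" "j < dim_col (B * V)"
    then have ij: "i < Suc N" "j < Suc N" by (auto simp: B_def V_def)
    have "(B * V) $$ (i, j) = (\<Sum>k<Suc N. B $$ (i, k) * V $$ (k, j))"
      using ij by (simp add: scalar_prod_def B_def V_def atLeast0LessThan)
    also have "\<dots> = (\<Sum>k<Suc N. (if k = j then B $$ (i, k) else 0) +
        (if Suc k = j then - a * B $$ (i, k) else 0))"
      using ij by (intro sum.cong) (auto simp: V_def)
    also have "\<dots> = B $$ (i, j) + (case j of 0 \<Rightarrow> 0 | Suc k \<Rightarrow> - a * B $$ (i, k))"
      using ij by (simp add: sum.distrib split: nat.split del: sum.lessThan_Suc)
    \<comment> \<open>For \<open>j = 0\<close> the coefficient of x^N in (x - a) \<open>s i\<close>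
      also contains - a times coefficient \<open>N\<close> of \<open>s i\<close>; the assumption
      \<open>deg\<close> removes it.\<close>
    also have "\<dots> = coeff (r i) (N - j)"
    proof (cases "i = N")
      case True
      then show ?thesis using ij deg[of i]
        by (cases "N - j") (auto simp: B_def r' split: nat.splits intro!: arg_cong[where f = "coeff (s N)"])
    next
      case False
      then show ?thesis using ij deg[of i]
        by (cases "N - j") (auto simp: B_def r split: nat.splits intro!: arg_cong[where f = "coeff (s i)"])
    qed
    finally show "mat (Suc N) (Suc N) (\<lambda>(i, j). coeff (r i) (N - j)) $$ (i, j) = (B * V) $$ (i, j)"
      using ij by simp
  qed (auto simp: B_def V_def)
  moreover have "det (B * V) = det B * det V"
    by (rule det_mult[of _ "Suc N"]) (auto simp: B_def V_def)
  moreover have "det V = 1"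
  proof -
    have "det V = prod_list (diag_mat V)"
      by (rule det_upper_triangular[of _ "Suc N"]) (auto simp: V_def)
    also have "diag_mat V = map (\<lambda>_. 1) [0..<Suc N]"
      unfolding diag_mat_def by (intro map_cong) (auto simp: V_def)
    finally show ?thesis by (simp add: map_replicate_const)
  qed
  moreover have "det B = det (mat N N (\<lambda>(i, j). coeff (s i) (N - 1 - j))) * v"
  proof -
    let ?M = "mat N N (\<lambda>(i, j). coeff (s i) (N - 1 - j))"
    let ?L = "mat 1 N (\<lambda>(i, j). coeff (s N) (N - 1 - j))"
    \<comment> \<open>Above the corner entry \<open>v\<close> the last column of \<open>B\<close> is
      zero, so \<open>B\<close> is block lower triangular.\<close>
    have "B = four_block_mat ?M (0\<^sub>m N 1) ?L (mat 1 1 (\<lambda>_. v))"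
      by (rule eq_matI) (auto simp: B_def less_Suc_eq)
    also have "det \<dots> = det ?M * det (mat 1 1 (\<lambda>_. v))"
      by (rule det_four_block_mat_upper_right_zero[of _ N _ 1]) auto
    finally show ?thesis by (simp add: det_single)
  qed
  ultimately show ?thesis by simp
qed

text \<open>Each subtracted row is the original next row, not an already changed one, so all
  subtractions together are one left multiplication by the upper unitriangular matrix
  \<open>L\<close>.\<close>

lemma det_coeff_rows_subtract_next:
  fixes r :: "nat \<Rightarrow> 'a :: idom poly"
  shows "det (mat N N (\<lambda>(i, j). coeff (if n \<le> i \<and> Suc i < N then r i - smult a (r (Suc i)) else r i) (d j))) =
    det (mat N N (\<lambda>(i, j). coeff (r i) (d j)))" (is "det ?R' = det ?R")
proof -
  define L :: "'a mat" where "L = mat N N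
    (\<lambda>(i, k). if k = i then 1 else if n \<le> i \<and> k = Suc i then - a else 0)"
  have "?R' = L * ?R"
  proof (rule eq_matI)
    fix i j assume "i < dim_row (L * ?R)" "j < dim_col (L * ?R)"
    then have ij: "i < N" "j < N" by (auto simp: L_def)
    have "(L * ?R) $$ (i, j) = (\<Sum>k<N. L $$ (i, k) * ?R $$ (k, j))"
      using ij by (simp add: scalar_prod_def L_def atLeast0LessThan)
    also have "\<dots> = (\<Sum>k<N. (if k = i then coeff (r k) (d j) else 0) +
        (if k = Suc i then if n \<le> i then - a * coeff (r k) (d j) else 0 else 0))"
      using ij by (intro sum.cong) (auto simp: L_def)
    also have "\<dots> = ?R' $$ (i, j)"
      using ij by (simp add: sum.distrib)
    finally show "?R' $$ (i, j) = (L * ?R) $$ (i, j)" by simp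
  qed (auto simp: L_def)
  moreover have "det (L * ?R) = det L * det ?R"
    by (rule det_mult[of _ N]) (auto simp: L_def)
  moreover have "det L = 1"
  proof -
    have "det L = prod_list (diag_mat L)"
      by (rule det_upper_triangular[of _ N]) (auto simp: L_def)
    also have "diag_mat L = map (\<lambda>_. 1) [0..<N]"
      unfolding diag_mat_def by (intro map_cong) (auto simp: L_def)
    finally show ?thesis by (simp add: map_replicate_const)
  qed
  ultimately show ?thesis by simp
qed

text \<open>
  In the Sylvester matrix of \<open>(x - a) f\<close> and \<open>g\<close>, subtracting \<open>a\<close> times the next row from each
  row \<open>x\<^sup>k g\<close> with \<open>k > 0\<close> makes all rows multiples of \<open>x - a\<close>, except for the last one, which is \<open>g\<close>.
\<close>

lemma resultant_sub_linear_factor: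
  fixes f g :: "'a :: idom poly"
  assumes f: "degree f \<le> m" and g: "degree g \<le> n"
  shows "resultant_sub (Suc m) n ([:- a, 1:] * f) g = poly g a * resultant_sub m n f g"
proof -
  define N where "N = m + n"
  define r where "r i = (if i < n then monom 1 (n - 1 - i) * ([:- a, 1:] * f) else monom 1 (N - i) * g)" for i
  \<comment> \<open>These are the quotients of the reduced rows by x - a. The first \<open>N\<close>
    of them are exactly the Sylvester rows of \<open>f\<close> and \<open>g\<close>; the last is the
    quotient of \<open>g\<close>, whose remainder is \<open>poly g a\<close>.\<close>
  define s where "s i = (if i < n then monom 1 (n - 1 - i) * f
    else if i < N then monom 1 (N - 1 - i) * g else synthetic_div g a)" for i
  let ?r = "\<lambda>i. if n \<le> i \<and> Suc i < Suc N then r i - smult a (r (Suc i)) else r i"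
  have "degree ([:- a, 1:] * f) \<le> Suc m"
    using f degree_mult_le[of "[:- a, 1:]" f] by simp
  then have "resultant_sub (Suc m) n ([:- a, 1:] * f) g =
      det (mat (Suc N) (Suc N) (\<lambda>(i, j). coeff (r i) (N - j)))"
    using g unfolding r_def N_def by (subst resultant_sub_as_rows) (simp_all only: add_Suc diff_Suc_1)
  also have "\<dots> = det (mat (Suc N) (Suc N) (\<lambda>(i, j). coeff (?r i) (N - j)))"
    by (rule det_coeff_rows_subtract_next [symmetric])
  also have "\<dots> = poly g a * det (mat N N (\<lambda>(i, j). coeff (s i) (N - 1 - j)))"
  proof (rule det_coeff_rows_linear_factor)
    fix i assume i: "i < N"
    show "?r i = [:- a, 1:] * s i"
    proof (cases "i < n")
      case False
      then obtain k where k: "N - i = Suc k" using i by (metis Suc_diff_Suc)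
      then have "N - Suc i = k" by simp
      then show ?thesis using False i k by (simp add: r_def s_def monom_Suc)
    qed (simp add: r_def s_def mult.left_commute del: mult_pCons_left)
  next
    show "?r N = [:- a, 1:] * s N + [:poly g a:]"
      using synthetic_div_correct'[of a g] by (simp add: r_def s_def N_def)
  next
    fix i assume "i \<le> N"
    moreover have "coeff (synthetic_div g a) N = 0"
    \<comment> \<open>For constant \<open>g\<close> a degree comparison can fail, since
      \<open>N\<close> may be 0; there the quotient itself is zero.\<close>
    proof (cases "degree g = 0")
      case True
      then show ?thesis using synthetic_div_eq_0_iff[of g a] by simp
    next
      case False
      then show ?thesis using g by (intro coeff_eq_0) (simp add: degree_synthetic_div N_def)
    qed
    ultimately show "coeff (s i) N = 0"
      using f g by (auto simp: s_def coeff_monom_mult N_def intro!: coeff_eq_0)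
  qed
  also have "det (mat N N (\<lambda>(i, j). coeff (s i) (N - 1 - j))) = resultant_sub m n f g"
    unfolding resultant_sub_as_rows[OF f g] N_def [symmetric]
    by (intro arg_cong[where f = det] eq_matI) (auto simp: s_def N_def)
  finally show ?thesis .
qed

lemma resultant_sub_prod_linear_factors:
  fixes g :: "'a :: idom poly"
  assumes "degree g \<le> n"
  shows "resultant_sub d n (\<Prod>i<d. [:- \<alpha> i, 1:]) g = resultant_sub 0 n 1 g * (\<Prod>i<d. poly g (\<alpha> i))"
proof (induction d)
  case (Suc d)
  have "degree (\<Prod>i<d. [:- \<alpha> i, 1:]) \<le> d"
    using degree_prod_sum_le[of "{..<d}" "\<lambda>i. [:- \<alpha> i, 1:]"] by simp
  then have "resultant_sub (Suc d) n ([:- \<alpha> d, 1:] * (\<Prod>i<d. [:- \<alpha> i, 1:])) g =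
      poly g (\<alpha> d) * resultant_sub d n (\<Prod>i<d. [:- \<alpha> i, 1:]) g"
    using assms by (rule resultant_sub_linear_factor)
  then show ?case by (simp only: Suc.IH prod.lessThan_Suc mult_ac)
qed simp

text \<open>With no linear factors left, the determinant is 1; the scalar \<open>c\<close>
  multiplies the \<open>degree g\<close> rows that belong to the first polynomial.\<close>

lemma resultant_poisson:
  fixes g :: "'a :: idom poly" and d :: nat
  assumes "c \<noteq> 0"
  shows "resultant (smult c (\<Prod>i<d. [:- \<alpha> i, 1:])) g = c ^ degree g * (\<Prod>i<d. poly g (\<alpha> i))"
proof -
  have "degree (\<Prod>i<d. [:- \<alpha> i, 1:]) = d"
    by (subst degree_prod_sum_eq) auto
  moreover have "resultant_sub 0 (degree g) 1 g = 1"
    using resultant_1(1)[of g] by (simp add: resultant_sub)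
  ultimately show ?thesis
    using assms resultant_sub_prod_linear_factors[OF order.refl, where g = g and d = d and \<alpha> = \<alpha>]
    by (simp add: resultant_smult_left resultant_sub[of "prod _ _"] del: pCons_one)
qed

section \<open>Recurrence, special values and leading coefficient of \<open>p_poly\<close>\<close>

lemma fps_nth_one_minus_const_X_mult:
  fixes F :: "'a :: comm_ring_1 fps"
  shows "fps_nth ((1 - fps_const c * fps_X) * F) n =
    fps_nth F n - (case n of 0 \<Rightarrow> 0 | Suc m \<Rightarrow> c * fps_nth F m)"
  by (simp add: left_diff_distrib mult.assoc split: nat.split)

text \<open>The sequence \<open>q\<close> defined by the recurrence is multiplied by the factors of
  the denominator one at a time: its series becomes 1/(1 - At)^2, then 1/(1 - At), then 1.
  Uniqueness of the inverse gives \<open>q = p_poly\<close>.\<close>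

lemma p_poly_rec:
  "p_poly 0 = 1"
  "p_poly (Suc n) = [:- 1, 1:]\<^sup>2 * p_poly n + of_nat (n + 2) * [:1, 1:] ^ (2 * n + 2)"
proof -
  define A B :: "int poly" where "A = [:1, 1:]\<^sup>2" and "B = [:- 1, 1:]\<^sup>2"
  define q where "q = rec_nat 1 (\<lambda>n p. B * p + of_nat (n + 2) * A ^ (n + 1))"
  have q: "q 0 = 1" "\<And>n. q (Suc n) = B * q n + of_nat (n + 2) * A ^ (n + 1)"
    by (simp_all add: q_def)
  have 1: "(1 - fps_const B * fps_X) * Abs_fps q = Abs_fps (\<lambda>n. of_nat (n + 1) * A ^ n)"
    by (rule fps_ext) (simp add: fps_nth_one_minus_const_X_mult q split: nat.split)
  have 2: "(1 - fps_const A * fps_X) * Abs_fps (\<lambda>n. of_nat (n + 1) * A ^ n) = Abs_fps (\<lambda>n. A ^ n)"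
  proof (rule fps_ext)
    show "fps_nth ((1 - fps_const A * fps_X) * Abs_fps (\<lambda>n. of_nat (n + 1) * A ^ n)) n =
        fps_nth (Abs_fps (\<lambda>n. A ^ n)) n" for n
      by (cases n) (simp_all add: fps_nth_one_minus_const_X_mult algebra_simps)
  qed
  have 3: "(1 - fps_const A * fps_X) * Abs_fps (\<lambda>n. A ^ n) = 1"
  proof (rule fps_ext)
    show "fps_nth ((1 - fps_const A * fps_X) * Abs_fps (\<lambda>n. A ^ n)) n = fps_nth 1 n" for n
      by (cases n) (simp_all add: fps_nth_one_minus_const_X_mult)
  qed
  have gf: "gf_denominator = (1 - fps_const A * fps_X) * ((1 - fps_const A * fps_X) * (1 - fps_const B * fps_X))"
  proof -
    have "[:0, 1:] + 1 = ([:1, 1:] :: int poly)" "[:0, 1:] - 1 = ([:- 1, 1:] :: int poly)"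
      by (simp_all add: poly_eq_iff coeff_pCons split: nat.split)
    then show ?thesis
      by (simp only: gf_denominator_def A_def B_def power2_eq_square mult.assoc)
  qed
  have "gf_denominator * Abs_fps q = 1"
    by (simp only: gf mult.assoc 1 2 3)
  then have "q = p_poly" by (rule gf_p_poly_unique)
  then show "p_poly 0 = 1"
    "p_poly (Suc n) = [:- 1, 1:]\<^sup>2 * p_poly n + of_nat (n + 2) * [:1, 1:] ^ (2 * n + 2)"
    using q by (simp_all only: A_def B_def power_mult [symmetric] distrib_left mult_1_right)
qed

lemma poly_p_poly_neg_1: "poly (p_poly n) (- 1) = 4 ^ n"
  by (induction n) (simp_all add: p_poly_rec)

lemma poly_p_poly_1: "poly (p_poly n) 1 = int (n + 1) * 4 ^ n"
  by (induction n) (simp_all add: p_poly_rec power_mult)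

lemma poly_p_poly_0: "2 * poly (p_poly n) 0 = int (n + 1) * int (n + 2)"
  by (induction n) (simp_all add: p_poly_rec algebra_simps)

text \<open>The factor 2 avoids division in the integers. An upper bound on the degree suffices,
  because the coefficient at \<open>2 * n\<close> is nonzero.\<close>

lemma degree_and_coeff_p_poly: "degree (p_poly n) \<le> 2 * n \<and> 2 * coeff (p_poly n) (2 * n) = int (n + 1) * int (n + 2)"
proof (induction n)
  case (Suc n)
  have lin: "degree ([:1, 1:] ^ k :: int poly) = k" for k
    by (simp add: degree_power_eq)
  have lead: "coeff ([:1, 1:] ^ k :: int poly) k = 1" for k
    using lead_coeff_power[of "[:1, 1 :: int:]" k] unfolding lin by simp
  \<comment> \<open>Writing the product with (z - 1)^2 through shifts makes its coefficients
    directly readable.\<close>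
  have "[:- 1, 1:]\<^sup>2 * p_poly n = pCons 0 (pCons 0 (p_poly n)) - smult 2 (pCons 0 (p_poly n)) + p_poly n"
    by (simp add: power2_eq_square algebra_simps)
  then have rec: "p_poly (Suc n) = pCons 0 (pCons 0 (p_poly n)) - smult 2 (pCons 0 (p_poly n)) + p_poly n
      + smult (int (n + 2)) ([:1, 1:] ^ (2 * n + 2))"
    by (simp add: p_poly_rec of_nat_poly)
  have deg0: "coeff (p_poly n) i = 0" if "i > 2 * n" for i
    using Suc.IH that by (intro coeff_eq_0) auto
  have "degree (p_poly (Suc n)) \<le> 2 * Suc n"
  proof (rule degree_le, intro allI impI)
    fix i assume i: "2 * Suc n < i"
    then have "coeff ([:1, 1:] ^ (2 * n + 2) :: int poly) i = 0"
      by (intro coeff_eq_0) (simp only: lin, simp)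
    then show "coeff (p_poly (Suc n)) i = 0"
      using i deg0 unfolding rec by (auto simp: coeff_pCons split: nat.splits)
  qed
  moreover have "2 * coeff (p_poly (Suc n)) (2 * Suc n) = int (Suc n + 1) * int (Suc n + 2)"
    using Suc.IH deg0 lead[of "2 * n + 2"] unfolding rec by (simp add: algebra_simps)
  ultimately show ?case ..
qed (simp add: p_poly_rec)

section \<open>The first-order differential equation\<close>

text \<open>Differentiating the recurrence gives the induction step. Evaluation at an integer
  \<open>z\<close> reduces it to ring arithmetic in \<open>z\<close>, \<open>w\<close>,
  \<open>p\<close> and \<open>p'\<close>; agreement at all integers then yields the polynomial
  identity.\<close>

lemma p_poly_ode_values:
  "poly (pderiv (p_poly n)) z * (z * (z - 1)) =
    (2 * int (n + 1) * z + 2) * poly (p_poly n) z - int (n + 1) * int (n + 2) * (z + 1) ^ (2 * n + 1)"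
proof (induction n)
  case (Suc n)
  define N where "N = int n"
  define w where "w = (z + 1) ^ (2 * n + 1)"
  define p where "p = poly (p_poly n) z"
  define p' where "p' = poly (pderiv (p_poly n)) z"
  have w: "(1 + z) ^ (2 * n + 2) = (z + 1) * w" "(z + 1) ^ (2 * Suc n + 1) = (z + 1)\<^sup>2 * w"
    "(1 + z) ^ (2 * n + 1) = w"
    by (simp_all add: w_def algebra_simps power2_eq_square)
  have IH: "p' * (z * (z - 1)) = (2 * (N + 1) * z + 2) * p - (N + 1) * (N + 2) * w"
    using Suc.IH by (simp add: p_def p'_def w_def N_def algebra_simps)
  have pS: "poly (p_poly (Suc n)) z = (z - 1)\<^sup>2 * p + (N + 2) * ((z + 1) * w)"
    by (simp only: p_poly_rec poly_add poly_mult poly_power w(1)[symmetric])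
      (simp add: p_def N_def algebra_simps of_nat_poly)
  have pS': "poly (pderiv (p_poly (Suc n))) z = (z - 1)\<^sup>2 * p' + 2 * (z - 1) * p + (N + 2) * (2 * N + 2) * w"
  proof -
    have "pderiv ([:1, 1:] ^ (2 * n + 2) :: int poly) = smult (int (2 * n + 2)) ([:1, 1:] ^ (2 * n + 1))"
      using pderiv_power_Suc[of "[:1, 1::int:]" "2 * n + 1"] by (simp add: pderiv_pCons)
    moreover have "pderiv ([:- 1, 1:]\<^sup>2 :: int poly) = [:-2, 2:]"
      by (simp add: power2_eq_square pderiv_pCons numeral_poly)
    moreover have "poly [:1, 1:] z = z + 1" "poly [:- 1, 1:] z = z - 1" "poly [:- 2, 2:] z = 2 * (z - 1)"
      "poly (of_nat k) z = int k" for k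
      by (simp_all add: of_nat_poly)
    ultimately have "poly (pderiv (p_poly (Suc n))) z =
        (z - 1)\<^sup>2 * p' + p * (2 * (z - 1)) + int (n + 2) * (int (2 * n + 2) * w)"
      by (simp only: p_poly_rec pderiv_add pderiv_mult pderiv_of_nat poly_add poly_mult poly_smult poly_power
          w_def p_def p'_def poly_0 mult_zero_right add_0_right)
    then show ?thesis by (simp add: N_def algebra_simps)
  qed
  \<comment> \<open>The grouping leaves \<open>p'\<close> only inside the left side of
    \<open>IH\<close>, which can then be substituted.\<close>
  have "poly (pderiv (p_poly (Suc n))) z * (z * (z - 1)) =
      (z - 1)\<^sup>2 * (p' * (z * (z - 1))) + (2 * (z - 1) * p + (N + 2) * (2 * N + 2) * w) * (z * (z - 1))"
    unfolding pS' by (simp add: algebra_simps)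
  also have "\<dots> = (2 * (N + 2) * z + 2) * ((z - 1)\<^sup>2 * p + (N + 2) * ((z + 1) * w)) -
      (N + 2) * (N + 3) * ((z + 1)\<^sup>2 * w)"
    unfolding IH by (simp add: power2_eq_square algebra_simps)
  finally show ?case unfolding pS w(2) by (simp add: N_def algebra_simps)
qed (simp add: p_poly_rec)

lemma p_poly_ode:
  "pderiv (p_poly n) * ([:0, 1:] * [:- 1, 1:]) =
    [:2, 2 * int (n + 1):] * p_poly n -
      smult (int (n + 1) * int (n + 2)) ([:1, 1:] ^ (2 * n + 1))"
    (is "?L = ?R")
proof -
  have "poly ?L z = poly ?R z" for z
  proof -
    have "poly ([:0, 1:] * [:- 1, 1:]) z = z * (z - 1)" "poly [:2, 2 * int (n + 1):] z = 2 * int (n + 1) * z + 2"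
      "poly [:1, 1:] z = z + 1"
      by (simp_all add: algebra_simps)
    then show ?thesis
      using p_poly_ode_values[of n z] by (simp only: poly_mult poly_diff poly_smult poly_power)
  qed
  then show ?thesis by (intro poly_eq_poly_eq_iff[THEN iffD1] ext)
qed

section \<open>Evaluation of the discriminant\<close>

theorem proposition5p4:
  fixes n :: nat
  assumes "n \<ge> 1"
  shows "Disc (map_poly of_int (p_poly n) :: complex poly) =
           (-1) ^ n * 2 ^ (4 * n\<^sup>2 + 2)
             * of_nat (n + 1) powi (2 * int n - 3) * of_nat (n + 2) powi (2 * int n - 2)"
proof -
  define P where "P = (map_poly of_int (p_poly n) :: complex poly)"
  define u v :: complex where "u = of_nat (n + 1)" and "v = of_nat (n + 2)"
  have nz: "u \<noteq> 0" "v \<noteq> 0" unfolding u_def v_def of_nat_eq_0_iff by simp_all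
  have eval_int: "poly P (of_int k) = of_int (poly (p_poly n) k)" for k
    by (simp add: P_def of_int_hom.poly_map_poly)
  have "2 * coeff P (2 * n) = of_int (2 * coeff (p_poly n) (2 * n))" by (simp add: P_def)
  also have "2 * coeff (p_poly n) (2 * n) = int (n + 1) * int (n + 2)"
    using degree_and_coeff_p_poly by blast
  finally have lead: "coeff P (2 * n) = u * v / 2"
    by (simp add: u_def v_def field_simps)
  then have "2 * n \<le> degree P" using nz by (intro le_degree) auto
  moreover have "degree P \<le> 2 * n" using degree_and_coeff_p_poly[of n] by (simp add: P_def)
  ultimately have deg: "degree P = 2 * n" by simp
  define a where "a = u * v / 2"
  have a: "lead_coeff P = a" "a \<noteq> 0" using lead deg nz by (simp_all add: a_def)
  have deg': "degree (pderiv P) = 2 * n - 1" by (simp add: degree_pderiv deg)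
  obtain \<alpha> where "smult (lead_coeff P) (\<Prod>i<degree P. [:- \<alpha> i, 1:]) = P"
    by (rule complex_poly_decompose')
  then have \<alpha>: "P = smult a (\<Prod>i<2 * n. [:- \<alpha> i, 1:])"
    unfolding a(1) unfolding deg by (rule sym)
  have eval: "poly P z = a * (\<Prod>i<2 * n. z - \<alpha> i)" for z
    by (subst \<alpha>) (simp add: poly_prod)
  then have prods: "(\<Prod>i<2 * n. z - \<alpha> i) = poly P z / a" for z
    using a by simp
  \<comment> \<open>Reversing the differences costs no sign, as the number \<open>2 * n\<close> of
    factors is even.\<close>
  have prods': "(\<Prod>i<2 * n. \<alpha> i - z) = poly P z / a" for z
    unfolding prods [symmetric] using prod_uminus[of "\<lambda>i. z - \<alpha> i" "{..<2 * n}"] by simp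
  \<comment> \<open>The constant and leading coefficients of \<open>P\<close> coincide.\<close>
  have at0: "(\<Prod>i<2 * n. \<alpha> i) = 1"
  proof -
    have "2 * poly P 0 = of_int (2 * poly (p_poly n) 0)" using eval_int[of 0] by simp
    then have "poly P 0 = a" unfolding poly_p_poly_0 by (simp add: a_def u_def v_def field_simps)
    then show ?thesis using prods'[of 0] a by simp
  qed
  have at1: "(\<Prod>i<2 * n. \<alpha> i - 1) = u * 4 ^ n / a"
    using prods'[of 1] eval_int[of 1] by (simp add: poly_p_poly_1 u_def)
  have at_neg1: "(\<Prod>i<2 * n. \<alpha> i + 1) = 4 ^ n / a"
    using prods'[of "- 1"] eval_int[of "- 1"] by (simp add: poly_p_poly_neg_1)
  have root: "poly P (\<alpha> i) = 0" if "i < 2 * n" for i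
    unfolding eval using that by auto
  have "pderiv P * ([:0, 1:] * [:- 1, 1:]) = [:2, 2 * u:] * P - smult (u * v) ([:1, 1:] ^ (2 * n + 1))"
  proof -
    have "of_int_poly [:0, 1:] = ([:0, 1:] :: complex poly)" "of_int_poly [:- 1, 1:] = ([:- 1, 1:] :: complex poly)"
      "of_int_poly [:1, 1:] = ([:1, 1:] :: complex poly)" "of_int_poly [:2, 2 * int (n + 1):] = [:2, 2 * u:]"
      by (simp_all add: u_def)
    moreover have "of_int (int (n + 1) * int (n + 2)) = u * v"
      by (simp add: u_def v_def)
    ultimately show ?thesis
      using arg_cong[OF p_poly_ode[of n], of "map_poly (of_int :: int \<Rightarrow> complex)"]
      by (simp only: P_def of_int_hom.map_poly_pderiv of_int_poly_hom.hom_mult of_int_poly_hom.hom_minus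
          of_int_poly_hom.hom_power of_int_hom.map_poly_hom_smult)
  qed
  then have "poly (pderiv P * ([:0, 1:] * [:- 1, 1:])) z =
      poly ([:2, 2 * u:] * P - smult (u * v) ([:1, 1:] ^ (2 * n + 1))) z" for z
    by (rule arg_cong)
  moreover have "poly [:0, 1:] z = z" "poly [:- 1, 1:] z = z - 1" "poly [:1, 1:] z = z + 1" for z :: complex
    by simp_all
  ultimately have "poly (pderiv P) z * (z * (z - 1)) = poly [:2, 2 * u:] z * poly P z -
      u * v * (z + 1) ^ (2 * n + 1)" for z
    by (simp only: poly_mult poly_diff poly_smult poly_power)
  then have "poly (pderiv P) (\<alpha> i) * (\<alpha> i * (\<alpha> i - 1)) = - (u * v) * (\<alpha> i + 1) ^ (2 * n + 1)"
    if "i < 2 * n" for i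
    using root[OF that] by simp
  then have "(\<Prod>i<2 * n. poly (pderiv P) (\<alpha> i) * (\<alpha> i * (\<alpha> i - 1))) =
      (\<Prod>i<2 * n. - (u * v) * (\<alpha> i + 1) ^ (2 * n + 1))"
    by (intro prod.cong) auto
  \<comment> \<open>The sign of \<open>- (u * v)\<close> disappears in the product of
    \<open>2 * n\<close> factors.\<close>
  then have "(\<Prod>i<2 * n. poly (pderiv P) (\<alpha> i)) * (u * 4 ^ n / a) =
      (u * v) ^ (2 * n) * (4 ^ n / a) ^ (2 * n + 1)"
    by (simp only: prod.distrib at0 at1 prod_power_distrib [symmetric] at_neg1) simp
  moreover have "u * v = 2 * a" by (simp add: a_def)
  ultimately have "(\<Prod>i<2 * n. poly (pderiv P) (\<alpha> i)) =
      (2 * a) ^ (2 * n) * (4 ^ n / a) ^ (2 * n + 1) * (a / (u * 4 ^ n))"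
    using nz a by (simp add: field_simps)
  also have "\<dots> = 2 ^ (2 * n) * (4 ^ n) ^ (2 * n) / u"
    using nz a by (simp add: field_simps)
  also have "2 ^ (2 * n) * (4 ^ n) ^ (2 * n) = (2 ^ (2 * n + 4 * n\<^sup>2) :: complex)"
  proof -
    have "(4 :: complex) = 2\<^sup>2" by simp
    then have "((4 :: complex) ^ n) ^ (2 * n) = 2 ^ (2 * n * (2 * n))"
      by (simp only: power_mult)
    then show ?thesis by (simp add: power_add power2_eq_square mult_ac)
  qed
  finally have prod: "(\<Prod>i<2 * n. poly (pderiv P) (\<alpha> i)) = 2 ^ (2 * n + 4 * n\<^sup>2) / u" .
  have "resultant P (pderiv P) = a ^ (2 * n - 1) * (2 ^ (2 * n + 4 * n\<^sup>2) / u)"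
    using resultant_poisson[OF a(2), of \<alpha> "2 * n" "pderiv P"] unfolding \<alpha> [symmetric] deg' prod .
  \<comment> \<open>One factor \<open>a\<close> is split off to cancel the inverse leading
    coefficient in \<open>Disc\<close>.\<close>
  moreover have "a ^ (2 * n - 1) = a * a ^ (2 * n - 2)"
    using assms by (cases n) auto
  moreover have "(- 1) ^ (2 * n * (2 * n - 1) div 2) = ((- 1) ^ n :: complex)"
  proof -
    have "2 * n * (2 * n - 1) div 2 = (2 * n - 1) * n" by simp
    moreover have "(- 1 :: complex) ^ (2 * n - 1) = - 1" using assms by simp
    ultimately show ?thesis by (simp only: power_mult)
  qed
  ultimately have "Disc P = (- 1) ^ n * (a ^ (2 * n - 2) * 2 ^ (2 * n + 4 * n\<^sup>2) / u)"
    unfolding Disc_def using a by (simp add: deg field_simps)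
  also have "a ^ (2 * n - 2) = u ^ (2 * n - 2) * v ^ (2 * n - 2) / 2 ^ (2 * n - 2)"
    by (simp add: a_def power_divide power_mult_distrib)
  \<comment> \<open>The halves in the power of \<open>a\<close> absorb 2^(2n - 2).\<close>
  also have "(2 :: complex) ^ (2 * n + 4 * n\<^sup>2) = 2 ^ (4 * n\<^sup>2 + 2) * 2 ^ (2 * n - 2)"
  proof -
    have "2 * n + 4 * n\<^sup>2 = 4 * n\<^sup>2 + 2 + (2 * n - 2)" using assms by simp
    then show ?thesis by (simp only: power_add)
  qed
  also have "v ^ (2 * n - 2) = v powi (2 * int n - 2)"
    using assms by (simp add: power_int_def nat_diff_distrib nat_mult_distrib)
  \<comment> \<open>The separated \<open>u\<close> cancels the denominator. For n = 1 the exponent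
    2n - 3 is -1, hence the integer power.\<close>
  also have "u ^ (2 * n - 2) = u powi (2 * int n - 3) * u"
    using assms nz power_int_add_1[of u "2 * int n - 3"]
    by (simp add: power_int_def nat_diff_distrib nat_mult_distrib)
  finally show ?thesis using nz unfolding P_def [symmetric] u_def [symmetric] v_def [symmetric] by simp
qed
end
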